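(* Let $c\in\mathbf{R}$, $c\neq0$. An open umbrella $f:(\mathbf{R}^2,0)\to M$ cannot be a generalized geometric solution to the Monge-Ampère system $\mathrm{Hess}=c$ on $M=\mathbf{R}^5$ (respectively, to the Monge-Ampère system $K=c$ on $M=\mathbf{R}^3\times S^2$).
   Context: All maps are $C^\infty$. System $\mathrm{Hess}=c$: on $M=\mathbf{R}^5$ with coordinates $(x,y,z,p,q)$, the contact form is $\theta=dz-p\,dx-q\,dy$ and the 2-form is $\omega=c\,dx\wedge dy-dp\wedge dq$. System $K=c$: on $M=\mathbf{R}^3\times S^2\subset\mathbf{R}^3\times\mathbf{R}^3$ with coordinates $(x_1,x_2,x_3;y_1,y_2,y_3)$, $y_1^2+y_2^2+y_3^2=1$, the contact form is $\theta=y_1dx_1+y_2dx_2+y_3dx_3$ and the 2-form is $\omega=c(y_1dx_2\wedge dx_3+y_2dx_3\wedge dx_1+y_3dx_1\wedge dx_2)-(y_1dy_2\wedge dy_3+y_2dy_3\wedge dy_1+y_3dy_1\wedge dy_2)$ (restricted to $M$). A map-germ $f:(\mathbf{R}^2,0)\to M$, not necessarily an immersion, is integral if $f^*\theta=0$; it is a generalized geometric solution of the system if $f^*\theta=0$ and $f^*\omega=0$. An integral map-germ $f:(\mathbf{R}^2,0)\to M$ into a contact 5-manifold is an open umbrella if it is contactomorphic to the germ at $0$ of $(u,v)\mapsto(x,y,z,p,q)=(u,\ v^2,\ uv^3,\ v^3,\ \tfrac32uv)$ in $\mathbf{R}^5$ with contact form $dz-p\,dx-q\,dy$; that is, the two germs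 agree after a diffeomorphism germ of the source and a contactomorphism germ of the target (the contactomorphism is not required to preserve any Legendrian fibration). *)

theory Defs
  imports "HOL-Analysis.Analysis"
begin

section \<open>Smooth maps and diffeomorphism germs\<close>

text \<open>Class $C^k$ on an open set: all iterated directional derivatives up to order $k$ exist
  and are continuous.\<close>

primrec Ck_on :: "nat \<Rightarrow> 'a::euclidean_space set \<Rightarrow> ('a \<Rightarrow> 'b::euclidean_space) \<Rightarrow> bool" where
  "Ck_on 0 U f \<longleftrightarrow> continuous_on U f"
| "Ck_on (Suc k) U f \<longleftrightarrow> (\<forall>x\<in>U. f differentiable (at x)) \<and>
     (\<forall>v. Ck_on k U (\<lambda>x. frechet_derivative f (at x) v))"

definition smooth_open :: "'a::euclidean_space set \<Rightarrow> ('a \<Rightarrow> 'b::euclidean_space) \<Rightarrow> bool" where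
  "smooth_open U f \<longleftrightarrow> open U \<and> (\<forall>k. Ck_on k U f)"

text \<open>Smoothness on an arbitrary subset of a Euclidean space: local extendability to smooth maps
  on open sets.  On an embedded submanifold this is the intrinsic notion.\<close>

definition smooth_on :: "'a::euclidean_space set \<Rightarrow> ('a \<Rightarrow> 'b::euclidean_space) \<Rightarrow> bool" where
  "smooth_on S f \<longleftrightarrow>
     (\<forall>x\<in>S. \<exists>U F. x \<in> U \<and> smooth_open U F \<and> (\<forall>y\<in>S \<inter> U. F y = f y))"

definition diffeomorphism ::
  "'a::euclidean_space set \<Rightarrow> 'b::euclidean_space set \<Rightarrow> ('a \<Rightarrow> 'b) \<Rightarrow> ('b \<Rightarrow> 'a) \<Rightarrow> bool" where
  "diffeomorphism S T f g \<longleftrightarrow>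
     f ` S \<subseteq> T \<and> g ` T \<subseteq> S \<and> (\<forall>x\<in>S. g (f x) = x) \<and> (\<forall>y\<in>T. f (g y) = y) \<and>
     smooth_on S f \<and> smooth_on T g"

text \<open>A germ is represented by any function that represents it near the base point; the values
  far away are irrelevant.\<close>

definition diffeo_germ ::
  "'a::euclidean_space set \<Rightarrow> 'a \<Rightarrow> 'b::euclidean_space set \<Rightarrow> 'b \<Rightarrow> ('a \<Rightarrow> 'b) \<Rightarrow> bool" where
  "diffeo_germ M a N b \<Phi> \<longleftrightarrow>
     \<Phi> a = b \<and>
     (\<exists>U V \<Psi>. openin (top_of_set M) U \<and> a \<in> U \<and> openin (top_of_set N) V \<and> b \<in> V \<and>
        diffeomorphism U V \<Phi> \<Psi>)"

text \<open>Smooth map-germs at the origin of the plane with values in \<open>M\<close>; no immersion condition.\<close>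

definition smooth_map_germ :: "'a::euclidean_space set \<Rightarrow> (real^2 \<Rightarrow> 'a) \<Rightarrow> bool" where
  "smooth_map_germ M f \<longleftrightarrow> (\<exists>U. 0 \<in> U \<and> smooth_open U f \<and> f ` U \<subseteq> M)"


section \<open>Differential forms\<close>

text \<open>Forms on a submanifold \<open>M\<close> are given by forms on the ambient Euclidean space.  Restricting
  them to \<open>M\<close> is implicit: they are only ever pulled back along maps from open sets into \<open>M\<close>,
  whose derivatives take values in the tangent spaces of \<open>M\<close>.\<close>

type_synonym 'a one_form = "'a \<Rightarrow> 'a \<Rightarrow> real"
type_synonym 'a two_form = "'a \<Rightarrow> 'a \<Rightarrow> 'a \<Rightarrow> real"

definition wedge :: "'a one_form \<Rightarrow> 'a one_form \<Rightarrow> 'a two_form"  (infixr "\<and>\<^sub>d" 75) where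
  "(\<alpha> \<and>\<^sub>d \<beta>) m v w = \<alpha> m v * \<beta> m w - \<alpha> m w * \<beta> m v"

definition pullback1 ::
  "('a::euclidean_space \<Rightarrow> 'b::euclidean_space) \<Rightarrow> 'b one_form \<Rightarrow> 'a one_form" where
  "pullback1 f \<theta> x v = \<theta> (f x) (frechet_derivative f (at x) v)"

definition pullback2 ::
  "('a::euclidean_space \<Rightarrow> 'b::euclidean_space) \<Rightarrow> 'b two_form \<Rightarrow> 'a two_form" where
  "pullback2 f \<omega> x v w =
     \<omega> (f x) (frechet_derivative f (at x) v) (frechet_derivative f (at x) w)"

definition integral_germ ::
  "'a::euclidean_space set \<Rightarrow> 'a one_form \<Rightarrow> (real^2 \<Rightarrow> 'a) \<Rightarrow> bool" where
  "integral_germ M \<theta> f \<longleftrightarrow>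
     smooth_map_germ M f \<and> (\<forall>\<^sub>F x in nhds 0. \<forall>v. pullback1 f \<theta> x v = 0)"

definition generalized_geometric_solution ::
  "'a::euclidean_space set \<Rightarrow> 'a one_form \<Rightarrow> 'a two_form \<Rightarrow> (real^2 \<Rightarrow> 'a) \<Rightarrow> bool" where
  "generalized_geometric_solution M \<theta> \<omega> f \<longleftrightarrow>
     integral_germ M \<theta> f \<and> (\<forall>\<^sub>F x in nhds 0. \<forall>v w. pullback2 f \<omega> x v w = 0)"


section \<open>The system \<open>Hess = c\<close>\<close>

text \<open>The coordinates $(x,y,z,p,q)$ are the components with indices $1,\dots,5$.\<close>

definition coord5 :: "5 \<Rightarrow> (real^5) one_form" where
  "coord5 i m v = v $ i"

definition theta_Hess :: "(real^5) one_form" where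
  "theta_Hess m v = coord5 3 m v - m $ 4 * coord5 1 m v - m $ 5 * coord5 2 m v"

definition omega_Hess :: "real \<Rightarrow> (real^5) two_form" where
  "omega_Hess c m v w = c * (coord5 1 \<and>\<^sub>d coord5 2) m v w - (coord5 4 \<and>\<^sub>d coord5 5) m v w"


section \<open>The system \<open>K = c\<close>\<close>

definition M_K :: "((real^3) \<times> (real^3)) set" where
  "M_K = UNIV \<times> sphere 0 1"

definition dx :: "3 \<Rightarrow> ((real^3) \<times> (real^3)) one_form" where
  "dx i m v = fst v $ i"

definition dy :: "3 \<Rightarrow> ((real^3) \<times> (real^3)) one_form" where
  "dy i m v = snd v $ i"

definition theta_K :: "((real^3) \<times> (real^3)) one_form" where
  "theta_K m v = (let y = snd m in y $ 1 * dx 1 m v + y $ 2 * dx 2 m v + y $ 3 * dx 3 m v)"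

definition omega_K :: "real \<Rightarrow> ((real^3) \<times> (real^3)) two_form" where
  "omega_K c m v w = (let y = snd m in
     c * (y $ 1 * (dx 2 \<and>\<^sub>d dx 3) m v w + y $ 2 * (dx 3 \<and>\<^sub>d dx 1) m v w
          + y $ 3 * (dx 1 \<and>\<^sub>d dx 2) m v w)
     - (y $ 1 * (dy 2 \<and>\<^sub>d dy 3) m v w + y $ 2 * (dy 3 \<and>\<^sub>d dy 1) m v w
          + y $ 3 * (dy 1 \<and>\<^sub>d dy 2) m v w))"


section \<open>Open umbrellas\<close>

text \<open>Contactomorphism germs whose source is an open subset of a Euclidean space.\<close>

definition contactomorphism_germ ::
  "'a::euclidean_space one_form \<Rightarrow> 'a \<Rightarrow> 'b::euclidean_space set \<Rightarrow> 'b one_form \<Rightarrow> 'b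
     \<Rightarrow> ('a \<Rightarrow> 'b) \<Rightarrow> bool" where
  "contactomorphism_germ \<theta> a N \<theta>' b \<Phi> \<longleftrightarrow>
     diffeo_germ UNIV a N b \<Phi> \<and>
     (\<exists>U \<rho>. a \<in> U \<and> smooth_open U (\<rho> :: 'a \<Rightarrow> real) \<and> (\<forall>x\<in>U. \<rho> x \<noteq> 0) \<and>
        (\<forall>x\<in>U. \<forall>v. pullback1 \<Phi> \<theta>' x v = \<rho> x * \<theta> x v))"

definition umbrella_model :: "real^2 \<Rightarrow> real^5" where
  "umbrella_model w = (let u = w $ 1; v = w $ 2 in
     vector [u, v\<^sup>2, u * v ^ 3, v ^ 3, 3 / 2 * u * v])"

text \<open>The index type \<open>5\<close> is arithmetic modulo 5, so index $5$ is index $0$; \<open>vector\<close>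
  nevertheless lists the components with indices $1,\dots,5$ in this order.\<close>

lemma vector_5:
  "(vector [a, b, c, d, e] :: 'a::zero^5) $ 1 = a"
  "(vector [a, b, c, d, e] :: 'a::zero^5) $ 2 = b"
  "(vector [a, b, c, d, e] :: 'a::zero^5) $ 3 = c"
  "(vector [a, b, c, d, e] :: 'a::zero^5) $ 4 = d"
  "(vector [a, b, c, d, e] :: 'a::zero^5) $ 5 = e"
  unfolding vector_def by simp_all

definition open_umbrella ::
  "'a::euclidean_space set \<Rightarrow> 'a one_form \<Rightarrow> (real^2 \<Rightarrow> 'a) \<Rightarrow> bool" where
  "open_umbrella M \<theta> f \<longleftrightarrow>
     integral_germ M \<theta> f \<and>
     (\<exists>\<phi> \<Phi>. diffeo_germ (UNIV :: (real^2) set) 0 (UNIV :: (real^2) set) 0 \<phi> \<and>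
        contactomorphism_germ theta_Hess 0 M \<theta> (f 0) \<Phi> \<and>
        (\<forall>\<^sub>F w in nhds 0. f (\<phi> w) = \<Phi> (umbrella_model w)))"

end

theory Submission
  imports Defs
begin

text \<open>
  After composing with the contactomorphism germ \<open>\<Phi>\<close>, the condition \<open>f\<^sup>*\<omega> = 0\<close> says that
  \<open>\<Omega> = \<Phi>\<^sup>*\<omega>\<close> pulls back to zero along the model umbrella.  Write \<open>e\<^sub>x, e\<^sub>y, e\<^sub>p, e\<^sub>q\<close> for the basis of
  the contact hyperplane at \<open>0\<close>.  Along \<open>u = 0\<close> the pullback is \<open>v\<close> times an expression with value
  \<open>2 \<Omega>(e\<^sub>x, e\<^sub>y)\<close> and derivative \<open>3 (\<Omega>(e\<^sub>x, e\<^sub>p) - \<Omega>(e\<^sub>y, e\<^sub>q))\<close> at \<open>v = 0\<close>, because the curve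
  \<open>(0, v\<^sup>2, 0, v\<^sup>3, 0)\<close> has zero velocity there; along \<open>v = 0\<close> it is \<open>3/2 u \<Omega>(e\<^sub>x, e\<^sub>q)\<close>.  All three
  numbers therefore vanish.  On the other hand \<open>\<Phi>\<close> is conformally symplectic on the contact
  hyperplane at \<open>0\<close>, and there \<open>\<omega>\<close> satisfies \<open>\<omega> \<and> d\<theta> = 0\<close> and \<open>\<omega> \<and> \<omega> = c d\<theta> \<and> d\<theta>\<close>.  The first
  identity gives \<open>\<Omega>(e\<^sub>x, e\<^sub>p) + \<Omega>(e\<^sub>y, e\<^sub>q) = 0\<close>, hence \<open>\<Omega>(e\<^sub>x, \<cdot>) = 0\<close> on the hyperplane, and then
  \<open>\<Omega> \<and> \<Omega> = 0\<close>, against the second identity.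
\<close>

section \<open>Symmetry of second derivatives\<close>

lemma has_real_derivative_line:
  fixes g :: "'a::real_normed_vector \<Rightarrow> real"
  assumes "(g has_derivative g') (at (a + s *\<^sub>R v))"
  shows "((\<lambda>s. g (a + s *\<^sub>R v)) has_real_derivative g' v) (at s)"
proof -
  have "((\<lambda>s. g (a + s *\<^sub>R v)) has_derivative (\<lambda>h. g' (h *\<^sub>R v))) (at s)"
    by (rule has_derivative_compose[where f = "\<lambda>s. a + s *\<^sub>R v" and g = g])
      (auto intro!: derivative_eq_intros assms)
  moreover have "g' (h *\<^sub>R v) = h * g' v" for h
    using has_derivative_linear[OF assms] by (simp add: linear_scale)
  ultimately show ?thesis
    by (simp add: has_field_derivative_def mult.commute[of _ "g' v"])
qed

text \<open>The mean value theorem is applied twice, first along \<open>v\<close> and then along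
  \<open>w\<close>. The second difference is symmetric in the two directions while \<open>DD\<close>
  privileges one order, so comparing both orders yields Schwarz's theorem.\<close>

lemma second_difference_mvt:
  fixes G :: "'a::real_normed_vector \<Rightarrow> real"
  assumes G: "\<And>y. y \<in> W \<Longrightarrow> (G has_derivative (\<lambda>v. D v y)) (at y)"
    and D: "\<And>y. y \<in> W \<Longrightarrow> (D v has_derivative DD y) (at y)"
    and h: "0 < h" and W: "cball x (h * (norm v + norm w)) \<subseteq> W"
  obtains y where "dist y x \<le> h * (norm v + norm w)"
    and "G (x + h *\<^sub>R v + h *\<^sub>R w) - G (x + h *\<^sub>R v) - G (x + h *\<^sub>R w) + G x = h\<^sup>2 * DD y w"
proof -
  have near: "dist (x + s *\<^sub>R v + t *\<^sub>R w) x \<le> h * (norm v + norm w)"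
    if "0 \<le> s" "s \<le> h" "0 \<le> t" "t \<le> h" for s t
  proof -
    have "dist (x + s *\<^sub>R v + t *\<^sub>R w) x = norm (s *\<^sub>R v + t *\<^sub>R w)"
      by (simp add: dist_norm)
    also have "\<dots> \<le> s * norm v + t * norm w"
      using norm_triangle_ineq[of "s *\<^sub>R v" "t *\<^sub>R w"] that by simp
    also have "\<dots> \<le> h * norm v + h * norm w"
      using that by (intro add_mono mult_right_mono) auto
    finally show ?thesis by (simp add: distrib_left)
  qed
  then have inW: "x + s *\<^sub>R v + t *\<^sub>R w \<in> W" if "0 \<le> s" "s \<le> h" "0 \<le> t" "t \<le> h" for s t
    using W that by (auto simp: mem_cball dist_commute)
  have d: "((\<lambda>s. G (x + s *\<^sub>R v + t *\<^sub>R w)) has_real_derivative D v (x + s *\<^sub>R v + t *\<^sub>R w)) (at s)"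
    if "0 \<le> s" "s \<le> h" "0 \<le> t" "t \<le> h" for s t
    using has_real_derivative_line[of G "\<lambda>u. D u (x + s *\<^sub>R v + t *\<^sub>R w)" "x + t *\<^sub>R w" s v]
      G[OF inW[OF that]] by (simp add: add_ac)
  obtain \<xi> where \<xi>: "0 < \<xi>" "\<xi> < h" and
    e1: "(G (x + h *\<^sub>R v + h *\<^sub>R w) - G (x + h *\<^sub>R v)) - (G (x + 0 *\<^sub>R v + h *\<^sub>R w) - G (x + 0 *\<^sub>R v))
        = (h - 0) * (D v (x + \<xi> *\<^sub>R v + h *\<^sub>R w) - D v (x + \<xi> *\<^sub>R v))"
    using MVT2[of 0 h "\<lambda>s. G (x + s *\<^sub>R v + h *\<^sub>R w) - G (x + s *\<^sub>R v)"
        "\<lambda>s. D v (x + s *\<^sub>R v + h *\<^sub>R w) - D v (x + s *\<^sub>R v)",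
        OF h DERIV_diff[OF d[of _ h] d[of _ 0, simplified]]] h
    by auto
  obtain \<eta> where \<eta>: "0 < \<eta>" "\<eta> < h" and
    e2: "D v (x + \<xi> *\<^sub>R v + h *\<^sub>R w) - D v (x + \<xi> *\<^sub>R v + 0 *\<^sub>R w)
        = (h - 0) * DD (x + \<xi> *\<^sub>R v + \<eta> *\<^sub>R w) w"
    using MVT2[of 0 h "\<lambda>t. D v (x + \<xi> *\<^sub>R v + t *\<^sub>R w)" "\<lambda>t. DD (x + \<xi> *\<^sub>R v + t *\<^sub>R w) w"]
      h \<xi> has_real_derivative_line[OF D] inW[of \<xi>] by auto
  show thesis
  proof (rule that[of "x + \<xi> *\<^sub>R v + \<eta> *\<^sub>R w"])
    show "dist (x + \<xi> *\<^sub>R v + \<eta> *\<^sub>R w) x \<le> h * (norm v + norm w)"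
      using \<xi> \<eta> by (intro near) auto
  qed (use e1 e2 in \<open>simp add: power2_eq_square algebra_simps\<close>)
qed

text \<open>The same second difference is h^2 times \<open>DD v y w\<close> and h^2 times
  \<open>DD w y' v\<close>, with \<open>y\<close> and \<open>y'\<close> both close to
  \<open>x\<close>. Continuity at \<open>x\<close> then identifies the two limits.\<close>

lemma second_derivative_symmetric_real:
  fixes G :: "'a::real_normed_vector \<Rightarrow> real"
  assumes "open W" "x \<in> W"
    and G: "\<And>y. y \<in> W \<Longrightarrow> (G has_derivative (\<lambda>v. D v y)) (at y)"
    and D: "\<And>v y. y \<in> W \<Longrightarrow> (D v has_derivative DD v y) (at y)"
    and cont: "\<And>v w. isCont (\<lambda>y. DD v y w) x"
  shows "DD v x w = DD w x v"
proof (rule ccontr)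
  assume ne: "DD v x w \<noteq> DD w x v"
  \<comment> \<open>Half the gap: no common value can lie within distance less than \<open>e\<close>
    of both mixed derivatives.\<close>
  define e where "e = \<bar>DD v x w - DD w x v\<bar> / 2"
  have e: "e > 0" using ne by (simp add: e_def)
  obtain d1 where d1: "d1 > 0" "\<And>y. dist y x < d1 \<Longrightarrow> \<bar>DD v y w - DD v x w\<bar> < e"
    using cont[of v w] e unfolding continuous_at_eps_delta dist_real_def by meson
  obtain d2 where d2: "d2 > 0" "\<And>y. dist y x < d2 \<Longrightarrow> \<bar>DD w y v - DD w x v\<bar> < e"
    using cont[of w v] e unfolding continuous_at_eps_delta dist_real_def by meson
  obtain d3 where d3: "d3 > 0" "ball x d3 \<subseteq> W"
    using assms(1,2) open_contains_ball by meson
  define d where "d = min d1 (min d2 d3)"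
  \<comment> \<open>The summand 1 keeps the denominator positive when \<open>v\<close> and
    \<open>w\<close> vanish.\<close>
  define h where "h = d / (2 * (norm v + norm w + 1))"
  have d: "d > 0" using d1 d2 d3 by (simp add: d_def)
  have pos: "norm v + norm w + 1 > 0" by (simp add: add_nonneg_pos)
  then have h: "h > 0" using d by (simp add: h_def)
  have "h * (norm v + norm w + 1) = d / 2"
    unfolding h_def using pos by (metis nonzero_divide_mult_cancel_right divide_divide_eq_left' less_irrefl times_divide_eq_left nonzero_mult_div_cancel_right)
  then have hd: "h * (norm v + norm w) < d" using h d by (simp add: distrib_left)
  then have W: "cball x (h * (norm v + norm w)) \<subseteq> W"
    using d3(2) by (auto simp: d_def)
  obtain y where y: "dist y x \<le> h * (norm v + norm w)"
    "G (x + h *\<^sub>R v + h *\<^sub>R w) - G (x + h *\<^sub>R v) - G (x + h *\<^sub>R w) + G x = h\<^sup>2 * DD v y w"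
    using second_difference_mvt[OF G D h W] by blast
  have W': "cball x (h * (norm w + norm v)) \<subseteq> W" using W by (simp add: add.commute)
  obtain y' where y': "dist y' x \<le> h * (norm w + norm v)"
    "G (x + h *\<^sub>R w + h *\<^sub>R v) - G (x + h *\<^sub>R w) - G (x + h *\<^sub>R v) + G x = h\<^sup>2 * DD w y' v"
    using second_difference_mvt[OF G D h W'] by blast
  have swap: "x + h *\<^sub>R w + h *\<^sub>R v = x + h *\<^sub>R v + h *\<^sub>R w"
    by simp
  have "h\<^sup>2 * DD v y w = h\<^sup>2 * DD w y' v"
    using y(2) y'(2)[unfolded swap] by linarith
  then have eq: "DD v y w = DD w y' v" using h by simp
  have "\<bar>DD v y w - DD v x w\<bar> < e"
    using d1(2)[of y] y(1) hd by (simp add: d_def)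
  moreover have "\<bar>DD w y' v - DD w x v\<bar> < e"
    using d2(2)[of y'] y'(1) hd by (simp add: d_def add.commute)
  ultimately show False
    using eq by (simp add: e_def abs_if split: if_splits)
qed

lemma Ck_on_2:
  assumes "open W" "Ck_on 2 W F"
  shows "\<And>y. y \<in> W \<Longrightarrow> (F has_derivative frechet_derivative F (at y)) (at y)"
    and "\<And>v y. y \<in> W \<Longrightarrow> ((\<lambda>x. frechet_derivative F (at x) v) has_derivative
            frechet_derivative (\<lambda>x. frechet_derivative F (at x) v) (at y)) (at y)"
    and "\<And>v w y. y \<in> W \<Longrightarrow>
            isCont (\<lambda>y. frechet_derivative (\<lambda>x. frechet_derivative F (at x) v) (at y) w) y"
  using assms by (auto simp: numeral_2_eq_2 frechet_derivative_works[symmetric] continuous_on_eq_continuous_at)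

lemma second_derivative_symmetric:
  fixes F :: "'a::euclidean_space \<Rightarrow> 'b::euclidean_space"
  assumes "open W" "x \<in> W" "Ck_on 2 W F"
  shows "frechet_derivative (\<lambda>y. frechet_derivative F (at y) v) (at x) w
       = frechet_derivative (\<lambda>y. frechet_derivative F (at y) w) (at x) v"
proof (rule euclidean_eqI)
  fix b :: 'b
  note C = Ck_on_2[OF assms(1,3)]
  show "frechet_derivative (\<lambda>y. frechet_derivative F (at y) v) (at x) w \<bullet> b
       = frechet_derivative (\<lambda>y. frechet_derivative F (at y) w) (at x) v \<bullet> b"
  proof (rule second_derivative_symmetric_real[OF assms(1,2), where G = "\<lambda>y. F y \<bullet> b" and
        D = "\<lambda>v y. frechet_derivative F (at y) v \<bullet> b" and
        DD = "\<lambda>v y w. frechet_derivative (\<lambda>y. frechet_derivative F (at y) v) (at y) w \<bullet> b"])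
  qed (use C assms(2) in \<open>auto intro!: has_derivative_inner_left continuous_intros\<close>)
qed

section \<open>Linear algebra on the contact hyperplane\<close>

unbundle cross3_syntax

text \<open>The pairs (\<open>a\<close>, \<open>s\<close>) and (\<open>b\<close>, \<open>t\<close>)
  are conjugate for \<open>\<sigma>\<close> up to the factor \<open>r\<close>, like the images of
  the x, p and y, q directions. Two polynomial identities in the values of X, Y, P, Q at the four
  vectors give the contradiction, so one statement serves both systems.\<close>

lemma no_isotropic_symplectic_quadruple:
  fixes X Y P Q :: "'v \<Rightarrow> real" and c r :: real
  defines "\<sigma> \<equiv> \<lambda>v w. P v * X w - P w * X v + (Q v * Y w - Q w * Y v)"
  defines "\<omega> \<equiv> \<lambda>v w. c * (X v * Y w - X w * Y v) - (P v * Q w - P w * Q v)"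
  assumes "c \<noteq> 0" "r \<noteq> 0"
    and \<sigma>: "\<sigma> a s = r" "\<sigma> b t = r" "\<sigma> a b = 0" "\<sigma> a t = 0" "\<sigma> s b = 0" "\<sigma> s t = 0"
    and \<omega>: "\<omega> a b = 0" "\<omega> a t = 0" "\<omega> a s = \<omega> b t"
  shows False
proof -
  \<comment> \<open>The identity $\omega \wedge \sigma = 0$, evaluated at $(a, s, b, t)$.\<close>
  have "\<omega> a s * \<sigma> b t - \<omega> a b * \<sigma> s t + \<omega> a t * \<sigma> s b + \<omega> s b * \<sigma> a t - \<omega> s t * \<sigma> a b + \<omega> b t * \<sigma> a s = 0"
    unfolding \<sigma>_def \<omega>_def by algebra
  then have 0: "\<omega> a s = 0"
    using \<sigma> \<omega> assms(4) by simp
  \<comment> \<open>The identity $\omega \wedge \omega = c \sigma \wedge \sigma$, evaluated at $(a, s, b, t)$.\<close>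
  have "\<omega> a s * \<omega> b t - \<omega> a b * \<omega> s t + \<omega> a t * \<omega> s b
      = c * (\<sigma> a s * \<sigma> b t - \<sigma> a b * \<sigma> s t + \<sigma> a t * \<sigma> s b)"
    unfolding \<sigma>_def \<omega>_def by algebra
  then show False
    using 0 \<sigma> \<omega> assms(3,4) by simp
qed

text \<open>An oriented orthonormal basis (\<open>e\<close>, \<open>f\<close>) of the plane
  orthogonal to \<open>y\<close> gives coordinates in which the area form and the inner product of
  that plane take their standard shape.\<close>

lemma orthonormal_frame:
  fixes y :: "real^3"
  assumes "norm y = 1"
  obtains e f :: "real^3" where
    "\<And>\<xi> \<eta>. y \<bullet> (\<xi> \<times> \<eta>) = (e \<bullet> \<xi>) * (f \<bullet> \<eta>) - (e \<bullet> \<eta>) * (f \<bullet> \<xi>)"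
    "\<And>\<xi> \<eta>. y \<bullet> \<xi> = 0 \<Longrightarrow> \<xi> \<bullet> \<eta> = (e \<bullet> \<xi>) * (e \<bullet> \<eta>) + (f \<bullet> \<xi>) * (f \<bullet> \<eta>)"
proof -
  obtain e0 :: "real^3" where e0: "e0 \<noteq> 0" "orthogonal y e0"
    using orthogonal_to_vector_exists[of y] by auto
  define e where "e = sgn e0"
  have e: "e \<bullet> e = 1" "y \<bullet> e = 0" "e \<bullet> y = 0"
    using e0 by (auto simp: e_def sgn_div_norm orthogonal_def inner_commute dot_square_norm)
  have yy: "y \<bullet> y = 1" using assms by (simp add: dot_square_norm)
  \<comment> \<open>This choice makes (\<open>e\<close>, \<open>f\<close>, \<open>y\<close>)
    positively oriented, which fixes the sign in the determinant identity.\<close>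
  define f where "f = y \<times> e"
  have ef: "e \<times> f = y"
    using Lagrange[of e y e] e by (simp add: f_def)
  have det: "y \<bullet> (\<xi> \<times> \<eta>) = (e \<bullet> \<xi>) * (f \<bullet> \<eta>) - (e \<bullet> \<eta>) * (f \<bullet> \<xi>)" for \<xi> \<eta>
    unfolding ef[symmetric] by (rule dot_cross)
  show thesis
  proof (rule that[OF det])
    fix \<xi> \<eta> :: "real^3"
    assume \<xi>: "y \<bullet> \<xi> = 0"
    \<comment> \<open>Crossing with \<open>y\<close> is the quarter turn of the plane; it turns the
      area form into the inner product, so the second identity reduces to the first.\<close>
    have "y \<bullet> (\<xi> \<times> (y \<times> \<eta>)) = y \<bullet> ((\<xi> \<bullet> \<eta>) *\<^sub>R y - (\<xi> \<bullet> y) *\<^sub>R \<eta>)"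
      by (simp add: Lagrange)
    then have "\<xi> \<bullet> \<eta> = y \<bullet> (\<xi> \<times> (y \<times> \<eta>))"
      using \<xi> yy by (simp add: inner_diff_right inner_commute)
    moreover have "f \<bullet> (y \<times> \<eta>) = e \<bullet> \<eta>"
      using e yy by (simp add: f_def dot_cross inner_commute)
    moreover have "e \<bullet> (y \<times> \<eta>) = - (f \<bullet> \<eta>)"
      by (metis f_def cross_triple cross_skew inner_commute inner_minus_left)
    ultimately show "\<xi> \<bullet> \<eta> = (e \<bullet> \<xi>) * (e \<bullet> \<eta>) + (f \<bullet> \<xi>) * (f \<bullet> \<eta>)"
      by (simp add: det)
  qed
qed

section \<open>The two systems in planar coordinates\<close>

lemma omega_K_eq: "omega_K c m v w = c * (snd m \<bullet> (fst v \<times> fst w)) - snd m \<bullet> (snd v \<times> snd w)"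
  by (simp add: omega_K_def dx_def dy_def wedge_def Let_def cross3_simps)

lemma theta_K_eq: "theta_K m v = snd m \<bullet> fst v"
  by (simp add: theta_K_def dx_def Let_def inner_vec_def sum_3)

text \<open>Here \<open>\<sigma>\<close> is the exterior derivative of \<open>theta_K\<close>.
  Tangency to the sphere lets the frame at \<open>snd m\<close> rewrite it as dP \<and> dX + dQ
  \<and> dY, with X, Y read off from \<open>fst\<close> and P, Q from \<open>snd\<close>.\<close>

lemma no_isotropic_symplectic_quadruple_K:
  fixes a b s t :: "(real^3) \<times> (real^3)"
  defines "\<sigma> \<equiv> \<lambda>v w :: (real^3) \<times> (real^3). snd v \<bullet> fst w - snd w \<bullet> fst v"
  assumes "c \<noteq> 0" "r \<noteq> 0" "norm (snd m) = 1"
    and tangent: "\<And>v. v \<in> {a, b, s, t} \<Longrightarrow> snd m \<bullet> snd v = 0"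
    and \<sigma>: "\<sigma> a s = r" "\<sigma> b t = r" "\<sigma> a b = 0" "\<sigma> a t = 0" "\<sigma> s b = 0" "\<sigma> s t = 0"
    and \<omega>: "omega_K c m a b = 0" "omega_K c m a t = 0" "omega_K c m a s = omega_K c m b t"
  shows False
proof -
  obtain e f :: "real^3" where
    det: "\<And>\<xi> \<eta>. snd m \<bullet> (\<xi> \<times> \<eta>) = (e \<bullet> \<xi>) * (f \<bullet> \<eta>) - (e \<bullet> \<eta>) * (f \<bullet> \<xi>)" and
    inner: "\<And>\<xi> \<eta>. snd m \<bullet> \<xi> = 0 \<Longrightarrow> \<xi> \<bullet> \<eta> = (e \<bullet> \<xi>) * (e \<bullet> \<eta>) + (f \<bullet> \<xi>) * (f \<bullet> \<eta>)"
    using orthonormal_frame[OF assms(4)] by blast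
  have 1: "\<sigma> v w = (e \<bullet> snd v) * (e \<bullet> fst w) - (e \<bullet> snd w) * (e \<bullet> fst v)
     + ((f \<bullet> snd v) * (f \<bullet> fst w) - (f \<bullet> snd w) * (f \<bullet> fst v))"
    if "v \<in> {a, b, s, t}" "w \<in> {a, b, s, t}" for v w
    using inner[OF tangent[OF that(1)]] inner[OF tangent[OF that(2)]] by (simp add: \<sigma>_def)
  have 2: "omega_K c m v w = c * ((e \<bullet> fst v) * (f \<bullet> fst w) - (e \<bullet> fst w) * (f \<bullet> fst v))
     - ((e \<bullet> snd v) * (f \<bullet> snd w) - (e \<bullet> snd w) * (f \<bullet> snd v))" for v w
    by (simp add: omega_K_eq det)
  show False
    by (rule no_isotropic_symplectic_quadruple[where X = "\<lambda>v. e \<bullet> fst v" and Y = "\<lambda>v. f \<bullet> fst v" and P = "\<lambda>v. e \<bullet> snd v"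
        and Q = "\<lambda>v. f \<bullet> snd v", OF assms(2,3), of a s b t])
      (use \<sigma> \<omega> in \<open>simp_all flip: 1 2\<close>)
qed

text \<open>The coordinates x, y, p, q themselves serve as X, Y, P, Q; with this sign
  \<open>\<sigma>\<close> is minus the exterior derivative of \<open>theta_Hess\<close>.\<close>

lemma no_isotropic_symplectic_quadruple_Hess:
  fixes a b s t :: "real^5"
  defines "\<sigma> \<equiv> \<lambda>v w :: real^5. v $ 4 * w $ 1 - w $ 4 * v $ 1 + (v $ 5 * w $ 2 - w $ 5 * v $ 2)"
  assumes "c \<noteq> 0" "r \<noteq> 0"
    and \<sigma>: "\<sigma> a s = r" "\<sigma> b t = r" "\<sigma> a b = 0" "\<sigma> a t = 0" "\<sigma> s b = 0" "\<sigma> s t = 0"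
    and \<omega>: "omega_Hess c m a b = 0" "omega_Hess c m a t = 0" "omega_Hess c m a s = omega_Hess c m b t"
  shows False
  by (rule no_isotropic_symplectic_quadruple[where X = "\<lambda>v. v $ 1" and Y = "\<lambda>v. v $ 2" and P = "\<lambda>v. v $ 4"
        and Q = "\<lambda>v. v $ 5", OF assms(2,3), of a s b t])
    (use \<sigma> \<omega> in \<open>simp_all add: \<sigma>_def omega_Hess_def wedge_def coord5_def\<close>)

section \<open>Pulling back along the umbrella\<close>

lemma exhaust_5: "x = 1 \<or> x = 2 \<or> x = 3 \<or> x = 4 \<or> x = 5" for x :: 5
proof (induct x)
  case (of_int z)
  \<comment> \<open>The representative 0 is the index 5.\<close>
  then have "z = 0 \<or> z = 1 \<or> z = 2 \<or> z = 3 \<or> z = 4" by simp arith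
  then show ?case by auto
qed

text \<open>Expansion in basis vectors opens the model to termwise differentiation and to linear
  maps.\<close>

lemma vector_5_eq_sum:
  "(vector [a, b, c, d, e] :: real^5) =
     a *\<^sub>R axis 1 1 + b *\<^sub>R axis 2 1 + c *\<^sub>R axis 3 1 + d *\<^sub>R axis 4 1 + e *\<^sub>R axis 5 1"
proof -
  have "(vector [a, b, c, d, e] :: real^5) $ i =
     (a *\<^sub>R axis 1 1 + b *\<^sub>R axis 2 1 + c *\<^sub>R axis 3 1 + d *\<^sub>R axis 4 1 + e *\<^sub>R axis 5 1) $ i" for i
    using exhaust_5[of i] by (auto simp: vector_5 axis_def simp del: one_neq_zero)
  then show ?thesis by (simp add: vec_eq_iff)
qed

lemma axis_nth: "axis i (1::'a::zero_neq_one) $ j = of_bool (j = i)"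
  by (simp add: axis_def)

lemma umbrella_model_eq_sum:
  "umbrella_model w = (w $ 1) *\<^sub>R axis 1 1 + (w $ 2)\<^sup>2 *\<^sub>R axis 2 1 + (w $ 1 * w $ 2 ^ 3) *\<^sub>R axis 3 1
     + (w $ 2 ^ 3) *\<^sub>R axis 4 1 + (3 / 2 * w $ 1 * w $ 2) *\<^sub>R axis 5 1"
  by (simp add: umbrella_model_def vector_5_eq_sum Let_def)

lemma umbrella_model_has_derivative:
  "(umbrella_model has_derivative (\<lambda>h. (h $ 1) *\<^sub>R axis 1 1 + (2 * w $ 2 * h $ 2) *\<^sub>R axis 2 1
     + (h $ 1 * w $ 2 ^ 3 + 3 * w $ 1 * (w $ 2)\<^sup>2 * h $ 2) *\<^sub>R axis 3 1
     + (3 * (w $ 2)\<^sup>2 * h $ 2) *\<^sub>R axis 4 1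
     + (3 / 2 * (h $ 1 * w $ 2 + w $ 1 * h $ 2)) *\<^sub>R axis 5 1)) (at w)"
  unfolding umbrella_model_eq_sum[abs_def]
  by (auto intro!: derivative_eq_intros bounded_linear_imp_has_derivative[OF bounded_linear_vec_nth]
      simp: algebra_simps power2_eq_square fun_eq_iff) (simp add: scaleR_add_left[symmetric] field_simps)

lemma has_vector_derivative_curve:
  assumes "(g has_derivative g') (at (\<gamma> t))" "(\<gamma> has_vector_derivative d) (at t)"
  shows "((\<lambda>t. g (\<gamma> t)) has_vector_derivative g' d) (at t)"
proof -
  have "((\<lambda>t. g (\<gamma> t)) has_derivative (\<lambda>h. g' (h *\<^sub>R d))) (at t)"
    by (rule has_derivative_compose[where f = \<gamma> and g = g])
      (use assms in \<open>auto simp: has_vector_derivative_def\<close>)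
  moreover have "g' (h *\<^sub>R d) = h *\<^sub>R g' d" for h
    using has_derivative_linear[OF assms(1)] by (simp add: linear_scale)
  ultimately show ?thesis
    by (simp add: has_vector_derivative_def)
qed

text \<open>Vanishing is assumed only off 0 because it will come from dividing by a power of t.
  Continuity recovers the value at 0, and the difference quotient then gives the derivative.\<close>

lemma value_and_derivative_zero_if_eventually_zero:
  fixes h :: "real \<Rightarrow> real"
  assumes h: "(h has_real_derivative d) (at 0)" and z: "\<forall>\<^sub>F t in at 0. h t = 0"
  shows "h 0 = 0" and "d = 0"
proof -
  have "(h \<longlongrightarrow> h 0) (at 0)"
    using DERIV_isCont[OF h] by (simp add: isCont_def)
  moreover have "(h \<longlongrightarrow> 0) (at 0)"
    using z by (rule tendsto_eventually)
  ultimately show h0: "h 0 = 0"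
    using LIM_unique by blast
  have "((\<lambda>t. (h (0 + t) - h 0) / t) \<longlongrightarrow> d) (at 0)"
    using h by (simp add: DERIV_def)
  moreover have "((\<lambda>t. (h (0 + t) - h 0) / t) \<longlongrightarrow> 0) (at 0)"
    by (rule tendsto_eventually) (use z in \<open>auto elim!: eventually_mono simp: h0\<close>)
  ultimately show "d = 0"
    using LIM_unique by blast
qed

text \<open>The hypothesis \<open>der\<close> is the product rule along a curve of base points with
  velocity zero, where the coefficients of the form contribute nothing. The curves used below are
  built to have this property, so no derivative of \<open>\<omega>\<close> itself enters.\<close>

lemma umbrella_pullback_zero:
  fixes F :: "real^5 \<Rightarrow> 'b::euclidean_space" and \<omega> :: "'b two_form"
  defines "L \<equiv> \<lambda>i. frechet_derivative F (at 0) (axis i 1)"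
  assumes "open W" "0 \<in> W" "Ck_on 2 W F"
    and bil: "\<And>m. bilinear (\<omega> m)" and skew: "\<And>m v w. \<omega> m v w = - \<omega> m w v"
    and der: "\<And>m A B A' B'. (m has_vector_derivative 0) (at 0) \<Longrightarrow>
       (A has_vector_derivative A') (at 0) \<Longrightarrow> (B has_vector_derivative B') (at 0) \<Longrightarrow>
       ((\<lambda>t::real. \<omega> (m t) (A t) (B t)) has_real_derivative
          \<omega> (m 0) A' (B 0) + \<omega> (m 0) (A 0) B') (at 0)"
    and zero: "\<forall>\<^sub>F w in nhds 0. \<forall>v v'. pullback2 (F \<circ> umbrella_model) \<omega> w v v' = 0"
  shows "\<omega> (F 0) (L 1) (L 2) = 0" "\<omega> (F 0) (L 1) (L 5) = 0"
    "\<omega> (F 0) (L 1) (L 4) = \<omega> (F 0) (L 2) (L 5)"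
proof -
  define J where "J = (\<lambda>i x. frechet_derivative F (at x) (axis i 1))"
  note C = Ck_on_2[OF assms(2,4)]
  note add_l = bilinear_ladd[OF bil] and add_r = bilinear_radd[OF bil]
  note mul_l = bilinear_lmul[OF bil] and mul_r = bilinear_rmul[OF bil]
  note U = umbrella_model_has_derivative
  have U0: "umbrella_model 0 = 0"
    by (simp add: umbrella_model_eq_sum)
  have "isCont umbrella_model 0"
    using U[of 0] has_derivative_continuous by blast
  then have "\<forall>\<^sub>F w in nhds 0. umbrella_model w \<in> W"
    using assms(2,3) U0 by (simp add: continuous_at_open eventually_nhds)
  \<comment> \<open>The two arguments are the images under the derivative of \<open>F\<close> of the
    u- and v-partial derivatives of the model.\<close>
  then have zero': "\<forall>\<^sub>F w in nhds 0. umbrella_model w \<in> W \<and>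
      \<omega> (F (umbrella_model w))
        (J 1 (umbrella_model w) + w $ 2 ^ 3 *\<^sub>R J 3 (umbrella_model w) + (3 / 2 * w $ 2) *\<^sub>R J 5 (umbrella_model w))
        ((2 * w $ 2) *\<^sub>R J 2 (umbrella_model w) + (3 * w $ 1 * (w $ 2)\<^sup>2) *\<^sub>R J 3 (umbrella_model w)
          + (3 * (w $ 2)\<^sup>2) *\<^sub>R J 4 (umbrella_model w) + (3 / 2 * w $ 1) *\<^sub>R J 5 (umbrella_model w)) = 0"
    using zero
  proof eventually_elim
    case (elim w)
    let ?F' = "frechet_derivative F (at (umbrella_model w))"
    have lin: "linear ?F'"
      using C(1)[OF elim(1)] has_derivative_linear by blast
    have F': "frechet_derivative (F \<circ> umbrella_model) (at w) = ?F' \<circ> frechet_derivative umbrella_model (at w)"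
      unfolding frechet_derivative_at[OF U, symmetric]
      by (rule frechet_derivative_at[OF diff_chain_at[OF U C(1)[OF elim(1)]], symmetric])
    have U': "frechet_derivative umbrella_model (at w) = (\<lambda>h. (h $ 1) *\<^sub>R axis 1 1 + (2 * w $ 2 * h $ 2) *\<^sub>R axis 2 1
     + (h $ 1 * w $ 2 ^ 3 + 3 * w $ 1 * (w $ 2)\<^sup>2 * h $ 2) *\<^sub>R axis 3 1
     + (3 * (w $ 2)\<^sup>2 * h $ 2) *\<^sub>R axis 4 1
     + (3 / 2 * (h $ 1 * w $ 2 + w $ 1 * h $ 2)) *\<^sub>R axis 5 1)"
      using frechet_derivative_at[OF U] by simp
    have "pullback2 (F \<circ> umbrella_model) \<omega> w (axis 1 1) (axis 2 1) = 0"
      using elim by blast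
    then show ?case
      using elim(1)
      by (simp add: pullback2_def F' U' J_def linear_add[OF lin] linear_scale[OF lin] axis_def)
  qed
  have ax: "(axis 1 1 :: real^2) $ 1 = 1" "(axis 1 1 :: real^2) $ 2 = 0"
    "(axis 2 1 :: real^2) $ 1 = 0" "(axis 2 1 :: real^2) $ 2 = 1"
    by (simp_all add: axis_def)
  \<comment> \<open>The punctured filter \<open>at 0\<close> is chosen so that factors of t can be
    cancelled afterwards.\<close>
  have along: "\<forall>\<^sub>F t in at 0. P (t *\<^sub>R d)" if "\<forall>\<^sub>F w in nhds (0::real^2). P w" for P d
  proof -
    have "((\<lambda>t::real. t *\<^sub>R d) \<longlongrightarrow> 0) (at 0)"
      by (auto intro!: tendsto_eq_intros)
    then show ?thesis
      using that filterlim_iff by metis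
  qed
  \<comment> \<open>By the chain rule, zero velocity passes to the base point
    \<open>F (\<gamma> t)\<close> and to the frame vectors, so below only the explicit powers of t
    get differentiated.\<close>
  have J: "((\<lambda>t. J i (\<gamma> t)) has_vector_derivative 0) (at 0)"
    and F: "((\<lambda>t. F (\<gamma> t)) has_vector_derivative 0) (at 0)"
    if "(\<gamma> has_vector_derivative 0) (at 0)" "\<gamma> 0 = 0" for \<gamma> :: "real \<Rightarrow> real^5" and i
  proof -
    have "linear (frechet_derivative F (at 0))" "linear (frechet_derivative (J i) (at 0))"
      using C(1,2)[OF assms(3)] has_derivative_linear unfolding J_def by blast+
    then have z: "frechet_derivative F (at 0) 0 = 0" "frechet_derivative (J i) (at 0) 0 = 0"
      using linear_0 by blast+
    show "((\<lambda>t. J i (\<gamma> t)) has_vector_derivative 0) (at 0)"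
      using has_vector_derivative_curve[of "J i" "frechet_derivative (J i) (at 0)" \<gamma> 0 0] C(2)[OF assms(3)] that z
      by (simp add: J_def)
    show "((\<lambda>t. F (\<gamma> t)) has_vector_derivative 0) (at 0)"
      using has_vector_derivative_curve[of F "frechet_derivative F (at 0)" \<gamma> 0 0] C(1)[OF assms(3)] that z
      by simp
  qed
  define \<gamma> where "\<gamma> = (\<lambda>t::real. t\<^sup>2 *\<^sub>R axis 2 1 + (t ^ 3) *\<^sub>R axis 4 1 :: real^5)"
  have \<gamma>: "(\<gamma> has_vector_derivative 0) (at 0)" "\<gamma> 0 = 0"
    unfolding \<gamma>_def by (auto intro!: derivative_eq_intros simp: has_vector_derivative_def)
  have U\<gamma>: "umbrella_model (t *\<^sub>R axis 2 1) = \<gamma> t" for t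
    by (simp add: umbrella_model_eq_sum \<gamma>_def axis_def)
  \<comment> \<open>On the line u = 0 the u-partial is mapped to \<open>?A t\<close>, and the
    v-partial to t times \<open>?B t\<close>; the factor t is split off because it hides the
    first-order information.\<close>
  let ?A = "\<lambda>t. J 1 (\<gamma> t) + t ^ 3 *\<^sub>R J 3 (\<gamma> t) + (3 / 2 * t) *\<^sub>R J 5 (\<gamma> t)"
  let ?B = "\<lambda>t. 2 *\<^sub>R J 2 (\<gamma> t) + (3 * t) *\<^sub>R J 4 (\<gamma> t)"
  have A: "(?A has_vector_derivative (3 / 2) *\<^sub>R L 5) (at 0)"
    using J[OF \<gamma>] unfolding L_def J_def
    by (auto intro!: derivative_eq_intros simp: \<gamma>)
  have B: "(?B has_vector_derivative 3 *\<^sub>R L 4) (at 0)"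
    using J[OF \<gamma>] unfolding L_def J_def
    by (auto intro!: derivative_eq_intros simp: \<gamma>)
  have "\<forall>\<^sub>F t in at 0. \<omega> (F (\<gamma> t)) (?A t) (?B t) = 0"
    using along[OF zero', of "axis 2 1"] eventually_neq_at_within[of 0]
  proof eventually_elim
    case (elim t)
    have "\<omega> (F (\<gamma> t)) (?A t) (t *\<^sub>R ?B t) = 0"
      using elim by (simp add: U\<gamma> ax algebra_simps power2_eq_square)
    then show ?case
      using elim by (simp add: mul_r)
  qed
  from value_and_derivative_zero_if_eventually_zero[OF der[OF F[OF \<gamma>] A B] this]
  have 1: "\<omega> (F 0) (L 1) (2 *\<^sub>R L 2) = 0"
    and 2: "\<omega> (F 0) ((3 / 2) *\<^sub>R L 5) (2 *\<^sub>R L 2) + \<omega> (F 0) (L 1) (3 *\<^sub>R L 4) = 0"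
    by (simp_all add: \<gamma> J_def L_def)
  show "\<omega> (F 0) (L 1) (L 2) = 0"
    using 1 by (simp add: mul_r)
  have "\<omega> (F 0) (L 1) (L 4) = - \<omega> (F 0) (L 5) (L 2)"
    using 2 by (simp add: mul_r mul_l)
  moreover have "\<omega> (F 0) (L 5) (L 2) = - \<omega> (F 0) (L 2) (L 5)"
    by (rule skew)
  ultimately show "\<omega> (F 0) (L 1) (L 4) = \<omega> (F 0) (L 2) (L 5)"
    by simp
  \<comment> \<open>The substitution \<open>u = t\<^sup>2\<close> gives a curve of zero velocity, as \<open>der\<close> requires.\<close>
  define \<beta> where "\<beta> = (\<lambda>t::real. t\<^sup>2 *\<^sub>R axis 1 1 :: real^5)"
  have \<beta>: "(\<beta> has_vector_derivative 0) (at 0)" "\<beta> 0 = 0"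
    unfolding \<beta>_def by (auto intro!: derivative_eq_intros simp: has_vector_derivative_def)
  have U\<beta>: "umbrella_model (t\<^sup>2 *\<^sub>R axis 1 1) = \<beta> t" for t
    by (simp add: umbrella_model_eq_sum \<beta>_def axis_def)
  have "((\<lambda>t::real. t\<^sup>2) \<longlongrightarrow> 0) (at 0)"
    by (auto intro!: tendsto_eq_intros)
  \<comment> \<open>The reparametrized curve must stay off the origin, since the factor 3/2 u of the
    second argument has to be cancelled.\<close>
  moreover have "\<forall>\<^sub>F t::real in at 0. t\<^sup>2 \<noteq> 0"
    using eventually_neq_at_within[of 0] by eventually_elim simp
  ultimately have "filterlim (\<lambda>t::real. t\<^sup>2) (at 0) (at 0)"
    by (simp add: filterlim_at)
  from eventually_compose_filterlim[OF along[OF zero', of "axis 1 1"] this] eventually_neq_at_within[of 0]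
  have "\<forall>\<^sub>F t in at 0. \<omega> (F (\<beta> t)) (J 1 (\<beta> t)) (J 5 (\<beta> t)) = 0"
    by eventually_elim (simp add: U\<beta> ax mul_r)
  from value_and_derivative_zero_if_eventually_zero(1)[OF der[OF F[OF \<beta>] J[OF \<beta>] J[OF \<beta>]] this]
  show "\<omega> (F 0) (L 1) (L 5) = 0"
    by (simp add: \<beta> J_def L_def)
qed

text \<open>This is the exterior derivative of \<open>pullback1 F \<theta>\<close> =
  \<open>\<rho>\<close> times \<open>theta_Hess\<close> at 0. Here \<open>\<tau>\<close>
  differentiates the coefficients of \<open>\<theta>\<close>, so its antisymmetrization is
  d\<theta>. Differentiating once in each order and subtracting cancels the second derivatives of
  \<open>F\<close>.\<close>

lemma contact_pullback_symplectic:
  fixes F :: "real^5 \<Rightarrow> 'b::euclidean_space" and \<theta> :: "'b one_form"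
  assumes "open W" "0 \<in> W" "Ck_on 2 W F" "\<rho> differentiable at 0"
    and der: "\<And>m V m' V'. (m has_vector_derivative m') (at 0) \<Longrightarrow> (V has_vector_derivative V') (at 0) \<Longrightarrow>
       ((\<lambda>t::real. \<theta> (m t) (V t)) has_real_derivative \<theta> (m 0) V' + \<tau> m' (V 0)) (at 0)"
    and eq: "\<forall>\<^sub>F x in nhds 0. \<forall>v. pullback1 F \<theta> x v = \<rho> x * theta_Hess x v"
    and v: "v $ 3 = 0" "w $ 3 = 0"
  shows "\<tau> (frechet_derivative F (at 0) v) (frechet_derivative F (at 0) w)
       - \<tau> (frechet_derivative F (at 0) w) (frechet_derivative F (at 0) v)
       = \<rho> 0 * (w $ 4 * v $ 1 - v $ 4 * w $ 1 + (w $ 5 * v $ 2 - v $ 5 * w $ 2))"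
proof -
  note C = Ck_on_2[OF assms(1,3)]
  let ?L = "frechet_derivative F (at 0)"
  let ?D = "\<lambda>v. frechet_derivative (\<lambda>x. frechet_derivative F (at x) v) (at 0)"
  have *: "\<theta> (F 0) (?D v w) + \<tau> (?L w) (?L v) = - \<rho> 0 * (w $ 4 * v $ 1 + w $ 5 * v $ 2)"
    if "v $ 3 = 0" for v w
  proof -
    have line: "((\<lambda>t::real. t *\<^sub>R w) has_vector_derivative w) (at 0)"
      by (auto intro!: derivative_eq_intros)
    have d1: "((\<lambda>t::real. \<theta> (F (t *\<^sub>R w)) (frechet_derivative F (at (t *\<^sub>R w)) v)) has_real_derivative
        \<theta> (F 0) (?D v w) + \<tau> (?L w) (?L v)) (at 0)"
      using der[OF has_vector_derivative_curve[OF _ line, of F]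
          has_vector_derivative_curve[OF _ line, of "\<lambda>x. frechet_derivative F (at x) v"]] C(1,2)[OF assms(2)]
      by simp
    have \<rho>: "((\<lambda>t::real. \<rho> (t *\<^sub>R w)) has_real_derivative frechet_derivative \<rho> (at 0) w) (at 0)"
      using has_vector_derivative_curve[OF _ line, of \<rho>] assms(4)
      by (simp add: frechet_derivative_works has_real_derivative_iff_has_vector_derivative)
    \<comment> \<open>As \<open>v\<close> has no z-component, \<open>theta_Hess\<close> on
      \<open>v\<close> vanishes at t = 0, and therefore the derivative of \<open>\<rho>\<close>
      drops out.\<close>
    have "((\<lambda>t::real. \<rho> (t *\<^sub>R w) * (- (t * (w $ 4 * v $ 1 + w $ 5 * v $ 2)))) has_real_derivative
        - \<rho> 0 * (w $ 4 * v $ 1 + w $ 5 * v $ 2)) (at 0)"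
      by (rule derivative_eq_intros \<rho> refl)+ (simp add: algebra_simps)
    then have d2: "((\<lambda>t::real. \<rho> (t *\<^sub>R w) * theta_Hess (t *\<^sub>R w) v) has_real_derivative
        - \<rho> 0 * (w $ 4 * v $ 1 + w $ 5 * v $ 2)) (at 0)"
      using that by (simp add: theta_Hess_def coord5_def algebra_simps)
    have "((\<lambda>t::real. t *\<^sub>R w) \<longlongrightarrow> 0) (nhds 0)"
      by (auto intro!: tendsto_eq_intros filterlim_ident)
    then have "\<forall>\<^sub>F t in nhds (0::real). \<theta> (F (t *\<^sub>R w)) (frechet_derivative F (at (t *\<^sub>R w)) v)
        = \<rho> (t *\<^sub>R w) * theta_Hess (t *\<^sub>R w) v"
      using eq unfolding filterlim_iff pullback1_def by (smt (verit) eventually_mono)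
    from DERIV_cong_ev[OF refl this refl] d1 d2 DERIV_unique show ?thesis
      by blast
  qed
  show ?thesis
    using *[OF v(1), of w] *[OF v(2), of v] second_derivative_symmetric[OF assms(1,2,3), of v w]
    by (simp add: algebra_simps)
qed

section \<open>Open umbrellas and the two systems\<close>

lemma Ck_on_subset: "Ck_on k U f \<Longrightarrow> V \<subseteq> U \<Longrightarrow> Ck_on k V f"
  by (induction k arbitrary: f) (auto intro: continuous_on_subset)

lemma smooth_open_differentiable: "smooth_open U f \<Longrightarrow> x \<in> U \<Longrightarrow> f differentiable (at x)"
  unfolding smooth_open_def by (metis Ck_on.simps(2))

text \<open>Smoothness of a germ means local extendability; intersecting the open domain with that
  of an extension gives an open set on which the extension represents the germ.\<close>

lemma diffeo_germ_UNIV_smooth: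
  fixes \<Phi> :: "'a::euclidean_space \<Rightarrow> 'b::euclidean_space"
  assumes "diffeo_germ UNIV a N b \<Phi>"
  obtains W F where "a \<in> W" "smooth_open W F" "\<And>x. x \<in> W \<Longrightarrow> F x = \<Phi> x" "\<Phi> ` W \<subseteq> N"
proof -
  obtain U V \<Psi> where U: "openin (top_of_set UNIV) U" "a \<in> U"
    and V: "openin (top_of_set N) V" and d: "diffeomorphism U V \<Phi> \<Psi>"
    using assms unfolding diffeo_germ_def by blast
  obtain U' F where F: "a \<in> U'" "smooth_open U' F" "\<And>y. y \<in> U \<inter> U' \<Longrightarrow> F y = \<Phi> y"
    using d U(2) unfolding diffeomorphism_def smooth_on_def by blast
  show thesis
  proof (rule that[of "U \<inter> U'" F])
    show "smooth_open (U \<inter> U') F"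
      using F(2) U(1) unfolding smooth_open_def by (auto intro: Ck_on_subset)
    show "\<Phi> ` (U \<inter> U') \<subseteq> N"
      using d openin_imp_subset[OF V] unfolding diffeomorphism_def by auto
  qed (use U F in auto)
qed

text \<open>Near 0 the composites of \<open>F\<close> with the model and of \<open>f\<close> with
  the source diffeomorphism coincide, so by the chain rule the vanishing of the pullback of
  \<open>\<omega>\<close> along \<open>f\<close> passes to the model.\<close>

lemma umbrella_solution_normal_form:
  fixes f :: "real^2 \<Rightarrow> 'b::euclidean_space"
  assumes "open_umbrella M \<theta> f" "generalized_geometric_solution M \<theta> \<omega> f"
  obtains W F \<rho> where "open W" "0 \<in> W" "Ck_on 2 W F" "F ` W \<subseteq> M"
    "\<rho> differentiable at 0" "\<rho> 0 \<noteq> 0"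
    "\<forall>\<^sub>F x in nhds 0. \<forall>v. pullback1 F \<theta> x v = \<rho> x * theta_Hess x v"
    "\<forall>\<^sub>F w in nhds 0. \<forall>v v'. pullback2 (F \<circ> umbrella_model) \<omega> w v v' = 0"
proof -
  obtain \<phi> \<Phi> where \<phi>: "diffeo_germ UNIV 0 UNIV 0 \<phi>"
    and \<Phi>: "contactomorphism_germ theta_Hess 0 M \<theta> (f 0) \<Phi>"
    and eq: "\<forall>\<^sub>F w in nhds 0. f (\<phi> w) = \<Phi> (umbrella_model w)"
    using assms(1) unfolding open_umbrella_def by blast
  obtain W F where W: "0 \<in> W" "smooth_open W F" "\<And>x. x \<in> W \<Longrightarrow> F x = \<Phi> x" "\<Phi> ` W \<subseteq> M"
    using diffeo_germ_UNIV_smooth \<Phi> unfolding contactomorphism_germ_def by metis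
  have oW: "open W" "Ck_on 2 W F"
    using W(2) by (auto simp: smooth_open_def)
  obtain R \<rho> where R: "0 \<in> R" "smooth_open R \<rho>" "\<And>x. x \<in> R \<Longrightarrow> \<rho> x \<noteq> 0"
    and \<rho>: "\<And>x v. x \<in> R \<Longrightarrow> pullback1 \<Phi> \<theta> x v = \<rho> x * theta_Hess x v"
    using \<Phi> unfolding contactomorphism_germ_def by blast
  have "\<forall>\<^sub>F x in nhds 0. x \<in> W \<inter> R"
    using oW R W by (intro eventually_nhds_in_open) (auto simp: smooth_open_def)
  then have contact: "\<forall>\<^sub>F x in nhds 0. \<forall>v. pullback1 F \<theta> x v = \<rho> x * theta_Hess x v"
  proof eventually_elim
    case (elim x)
    have "F differentiable at x"
      using smooth_open_differentiable[OF W(2)] elim by blast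
    then have "frechet_derivative F (at x) = frechet_derivative \<Phi> (at x)"
      using frechet_derivative_transform_within_open[of F x W \<Phi>] oW W(3) elim by blast
    then show ?case
      using \<rho>[of x] W(3)[of x] elim by (simp add: pullback1_def)
  qed
  obtain S \<psi> where S: "0 \<in> S" "smooth_open S \<psi>" "\<And>x. x \<in> S \<Longrightarrow> \<psi> x = \<phi> x"
    using diffeo_germ_UNIV_smooth[OF \<phi>] by metis
  have \<psi>0: "\<psi> 0 = 0"
    using S \<phi> by (simp add: diffeo_germ_def)
  have tend: "filterlim \<psi> (nhds 0) (nhds 0)"
    using differentiable_imp_continuous_within[OF smooth_open_differentiable[OF S(2,1)]]
      tendsto_at_iff_tendsto_nhds[of \<psi> 0] \<psi>0
    by (simp add: continuous_within)
  obtain T where T: "0 \<in> T" "smooth_open T f"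
    using assms(1) unfolding open_umbrella_def integral_germ_def smooth_map_germ_def by blast
  have "\<forall>\<^sub>F x in nhds 0. x \<in> T \<and> (\<forall>v w. pullback2 f \<omega> x v w = 0)"
    using assms(2) T unfolding generalized_geometric_solution_def
    by (auto simp: smooth_open_def intro!: eventually_conj eventually_nhds_in_open)
  then have sol: "\<forall>\<^sub>F x in nhds 0. \<psi> x \<in> T \<and> (\<forall>v w. pullback2 f \<omega> (\<psi> x) v w = 0)"
    using tend by (rule eventually_compose_filterlim)
  have "isCont umbrella_model 0"
    using umbrella_model_has_derivative has_derivative_continuous by blast
  then have "\<forall>\<^sub>F w in nhds 0. umbrella_model w \<in> W"
    using oW(1) W(1) by (simp add: continuous_at_open eventually_nhds umbrella_model_eq_sum)
  moreover have inS: "\<forall>\<^sub>F w in nhds 0. w \<in> S"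
    using S by (intro eventually_nhds_in_open) (auto simp: smooth_open_def)
  ultimately have "\<forall>\<^sub>F w in nhds 0. (F \<circ> umbrella_model) w = (f \<circ> \<psi>) w"
    using eq by eventually_elim (simp add: W(3) S(3))
  \<comment> \<open>Equality on a whole neighbourhood of each nearby point is what transfers
    derivatives there.\<close>
  then have "\<forall>\<^sub>F w in nhds 0. \<forall>\<^sub>F w in nhds w. (F \<circ> umbrella_model) w = (f \<circ> \<psi>) w"
    by (simp add: eventually_eventually)
  then have "\<forall>\<^sub>F w in nhds 0. \<forall>v v'. pullback2 (F \<circ> umbrella_model) \<omega> w v v' = 0"
    using sol inS
  proof eventually_elim
    case (elim w)
    obtain O' where O': "open O'" "w \<in> O'" "\<And>w. w \<in> O' \<Longrightarrow> (F \<circ> umbrella_model) w = (f \<circ> \<psi>) w"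
      using elim(1) unfolding eventually_nhds by blast
    have df: "(f has_derivative frechet_derivative f (at (\<psi> w))) (at (\<psi> w))"
      and d\<psi>: "(\<psi> has_derivative frechet_derivative \<psi> (at w)) (at w)"
      using smooth_open_differentiable[OF T(2)] smooth_open_differentiable[OF S(2)] elim
      by (simp_all add: frechet_derivative_works[symmetric])
    note chain = diff_chain_at[OF d\<psi> df]
    have "frechet_derivative (F \<circ> umbrella_model) (at w) = frechet_derivative (f \<circ> \<psi>) (at w)"
      using frechet_derivative_transform_within_open[of "f \<circ> \<psi>" w O' "F \<circ> umbrella_model"]
        differentiableI[OF chain] O'
      by metis
    also have "\<dots> = frechet_derivative f (at (\<psi> w)) \<circ> frechet_derivative \<psi> (at w)"
      using frechet_derivative_at[OF chain] by simp
    finally show ?case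
      using elim(2) O'(3)[OF O'(2)] by (simp add: pullback2_def)
  qed
  with that[OF oW(1) W(1) oW(2), of \<rho>] show thesis
    using W(3,4) R contact smooth_open_differentiable[OF R(2,1)] by fastforce
qed

section \<open>Product rules along curves, bilinearity and tangency\<close>

lemma omega_Hess_curve_derivative:
  assumes "(A has_vector_derivative A') (at 0)" "(B has_vector_derivative B') (at 0)"
  shows "((\<lambda>t::real. omega_Hess c (m t) (A t) (B t)) has_real_derivative
          omega_Hess c (m 0) A' (B 0) + omega_Hess c (m 0) (A 0) B') (at 0)"
proof -
  have "((\<lambda>t. A t $ i) has_real_derivative A' $ i) (at 0)"
    "((\<lambda>t. B t $ i) has_real_derivative B' $ i) (at 0)" for i
    using bounded_linear.has_vector_derivative[OF bounded_linear_vec_nth] assms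
    by (auto simp: has_real_derivative_iff_has_vector_derivative)
  then show ?thesis
    unfolding omega_Hess_def wedge_def coord5_def
    by (auto intro!: derivative_eq_intros simp: algebra_simps)
qed

text \<open>The summand in parentheses is the \<open>\<tau>\<close> of this system: the derivative
  of the coefficients -p and -q along \<open>m'\<close>, applied to \<open>V 0\<close>.\<close>

lemma theta_Hess_curve_derivative:
  assumes "(m has_vector_derivative m') (at 0)" "(V has_vector_derivative V') (at 0)"
  shows "((\<lambda>t::real. theta_Hess (m t) (V t)) has_real_derivative
          theta_Hess (m 0) V' + (- (m' $ 4 * V 0 $ 1) - m' $ 5 * V 0 $ 2)) (at 0)"
proof -
  have "((\<lambda>t. m t $ i) has_real_derivative m' $ i) (at 0)"
    "((\<lambda>t. V t $ i) has_real_derivative V' $ i) (at 0)" for i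
    using bounded_linear.has_vector_derivative[OF bounded_linear_vec_nth] assms
    by (auto simp: has_real_derivative_iff_has_vector_derivative)
  then show ?thesis
    unfolding theta_Hess_def coord5_def
    by (auto intro!: derivative_eq_intros simp: algebra_simps)
qed

lemma omega_K_curve_derivative:
  assumes "(m has_vector_derivative 0) (at 0)"
    "(A has_vector_derivative A') (at 0)" "(B has_vector_derivative B') (at 0)"
  shows "((\<lambda>t::real. omega_K c (m t) (A t) (B t)) has_real_derivative
          omega_K c (m 0) A' (B 0) + omega_K c (m 0) (A 0) B') (at 0)"
proof -
  have comp: "((\<lambda>t. fst (g t)) has_vector_derivative fst g') (at 0)"
    "((\<lambda>t. snd (g t)) has_vector_derivative snd g') (at 0)"
    if "(g has_vector_derivative g') (at 0)" for g :: "real \<Rightarrow> (real^3) \<times> (real^3)" and g'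
    using that by (auto intro: bounded_linear.has_vector_derivative bounded_linear_fst bounded_linear_snd)
  have cross: "((\<lambda>t. g t \<times> h t) has_vector_derivative g 0 \<times> h' + g' \<times> h 0) (at 0)"
    if "(g has_vector_derivative g') (at 0)" "(h has_vector_derivative h') (at 0)"
    for g h :: "real \<Rightarrow> real^3" and g' h'
    using bilinear_cross that by (auto simp: bilinear_conv_bounded_bilinear intro: bounded_bilinear.has_vector_derivative)
  \<comment> \<open>Zero velocity of \<open>m\<close> removes the term that would differentiate the
    coefficients \<open>snd (m t)\<close>.\<close>
  have inner: "((\<lambda>t. snd (m t) \<bullet> g t) has_real_derivative snd (m 0) \<bullet> g') (at 0)"
    if "(g has_vector_derivative g') (at 0)" for g g'
    using bounded_bilinear.has_vector_derivative[OF bounded_bilinear_inner comp(2)[OF assms(1)] that]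
    by (simp add: has_real_derivative_iff_has_vector_derivative)
  have "((\<lambda>t::real. omega_K c (m t) (A t) (B t)) has_real_derivative
      c * (snd (m 0) \<bullet> (fst (A 0) \<times> fst B' + fst A' \<times> fst (B 0)))
      - snd (m 0) \<bullet> (snd (A 0) \<times> snd B' + snd A' \<times> snd (B 0))) (at 0)"
    unfolding omega_K_eq
    by (intro DERIV_diff DERIV_cmult inner cross comp assms)
  then show ?thesis
    by (simp add: omega_K_eq inner_add_right algebra_simps)
qed

lemma theta_K_curve_derivative:
  assumes "(m has_vector_derivative m') (at 0)" "(V has_vector_derivative V') (at 0)"
  shows "((\<lambda>t::real. theta_K (m t) (V t)) has_real_derivative
          theta_K (m 0) V' + snd m' \<bullet> fst (V 0)) (at 0)"
proof -
  have "((\<lambda>t. snd (m t)) has_vector_derivative snd m') (at 0)"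
    "((\<lambda>t. fst (V t)) has_vector_derivative fst V') (at 0)"
    using assms by (auto intro: bounded_linear.has_vector_derivative bounded_linear_fst bounded_linear_snd)
  from bounded_bilinear.has_vector_derivative[OF bounded_bilinear_inner this] show ?thesis
    by (simp add: theta_K_eq has_real_derivative_iff_has_vector_derivative)
qed

lemma bilinear_omega_Hess: "bilinear (omega_Hess c m)"
  unfolding bilinear_def omega_Hess_def wedge_def coord5_def
  by (auto intro!: linearI simp: algebra_simps)

lemma bilinear_omega_K: "bilinear (omega_K c m)"
  unfolding bilinear_def omega_K_def wedge_def dx_def dy_def Let_def
  by (auto intro!: linearI simp: algebra_simps)

text \<open>The squared norm of \<open>snd (F x)\<close> is constantly 1 on \<open>W\<close>, so its
  derivative, twice the inner product in question, vanishes.\<close>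

lemma derivative_tangent_sphere:
  fixes F :: "real^5 \<Rightarrow> (real^3) \<times> (real^3)"
  assumes "open W" "0 \<in> W" "F ` W \<subseteq> M_K" "(F has_derivative F') (at 0)"
  shows "snd (F 0) \<bullet> snd (F' v) = 0"
proof -
  have "((\<lambda>x. snd (F x) \<bullet> snd (F x)) has_derivative (\<lambda>v. snd (F 0) \<bullet> snd (F' v) + snd (F' v) \<bullet> snd (F 0))) (at 0)"
    by (intro has_derivative_inner has_derivative_snd assms)
  moreover have "((\<lambda>x. snd (F x) \<bullet> snd (F x)) has_derivative (\<lambda>v. 0)) (at 0)"
  proof (rule has_derivative_transform_within_open[OF has_derivative_const[of 1] assms(1,2)])
    fix x assume "x \<in> W"
    then have "F x \<in> M_K" using assms(3) by blast
    then show "1 = snd (F x) \<bullet> snd (F x)"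
      by (auto simp: M_K_def dot_square_norm)
  qed
  ultimately show ?thesis
    using has_derivative_unique by (fastforce simp: inner_commute dest: fun_cong)
qed

section \<open>The contradiction for each system\<close>

lemma open_umbrella_not_Hess_solution:
  assumes "c \<noteq> 0" "open_umbrella UNIV theta_Hess f"
  shows "\<not> generalized_geometric_solution UNIV theta_Hess (omega_Hess c) f"
proof
  assume sol: "generalized_geometric_solution UNIV theta_Hess (omega_Hess c) f"
  obtain W F \<rho> where
    W: "open W" "0 \<in> W" "Ck_on 2 W F" "F ` W \<subseteq> UNIV" and \<rho>: "\<rho> differentiable at 0" "\<rho> 0 \<noteq> 0"
    and contact: "\<forall>\<^sub>F x in nhds 0. \<forall>v. pullback1 F theta_Hess x v = \<rho> x * theta_Hess x v"
    and zero: "\<forall>\<^sub>F w in nhds 0. \<forall>v v'. pullback2 (F \<circ> umbrella_model) (omega_Hess c) w v v' = 0"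
    by (rule umbrella_solution_normal_form[OF assms(2) sol])
  define L where "L i = frechet_derivative F (at 0) (axis i 1)" for i :: 5
  have skew: "omega_Hess c m v w = - omega_Hess c m w v" for m v w
    by (simp add: omega_Hess_def wedge_def algebra_simps)
  note \<omega>0 = umbrella_pullback_zero[OF W(1-3) bilinear_omega_Hess _ omega_Hess_curve_derivative zero]
  have \<omega>: "omega_Hess c (F 0) (L 1) (L 2) = 0" "omega_Hess c (F 0) (L 1) (L 5) = 0"
    "omega_Hess c (F 0) (L 1) (L 4) = omega_Hess c (F 0) (L 2) (L 5)"
    unfolding L_def using \<omega>0 skew by blast+
  let ?D = "frechet_derivative F (at 0)"
  have \<sigma>: "- (?D v $ 4 * ?D w $ 1) - ?D v $ 5 * ?D w $ 2
      - (- (?D w $ 4 * ?D v $ 1) - ?D w $ 5 * ?D v $ 2)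
      = \<rho> 0 * (w $ 4 * v $ 1 - v $ 4 * w $ 1 + (w $ 5 * v $ 2 - v $ 5 * w $ 2))"
    if vw: "v $ 3 = 0" "w $ 3 = 0" for v w
  proof (rule contact_pullback_symplectic[where \<tau> = "\<lambda>a b. - (a $ 4 * b $ 1) - a $ 5 * b $ 2",
        OF W(1-3) \<rho>(1) _ contact vw])
    fix m V :: "real \<Rightarrow> real^5" and m' V'
    assume "(m has_vector_derivative m') (at 0)" "(V has_vector_derivative V') (at 0)"
    then show "((\<lambda>t. theta_Hess (m t) (V t)) has_real_derivative
        theta_Hess (m 0) V' + (- (m' $ 4 * V 0 $ 1) - m' $ 5 * V 0 $ 2)) (at 0)"
      by (rule theta_Hess_curve_derivative)
  qed
  \<comment> \<open>The sign of \<open>\<rho> 0\<close> flips because the left-hand side is minus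
    the exterior derivative of \<open>theta_Hess\<close>. Indices other than 3 select the contact
    hyperplane at the origin.\<close>
  have S: "L i $ 4 * L j $ 1 - L j $ 4 * L i $ 1 + (L i $ 5 * L j $ 2 - L j $ 5 * L i $ 2)
      = - \<rho> 0 * (of_bool (j = 4) * of_bool (i = 1) - of_bool (i = 4) * of_bool (j = 1)
          + (of_bool (j = 5) * of_bool (i = 2) - of_bool (i = 5) * of_bool (j = 2)))"
    if "i \<noteq> 3" "j \<noteq> 3" for i j
    unfolding L_def
    using \<sigma>[where v = "axis i 1" and w = "axis j 1"] that
    by (simp add: axis_nth)
  show False
    \<comment> \<open>The conjugate pairs are the images of the x, p and of the y, q
      directions.\<close>
    by (rule no_isotropic_symplectic_quadruple_Hess[OF assms(1), of "- \<rho> 0" "L 1" "L 4" "L 2" "L 5" "F 0"])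
      (use S[of 1 4] S[of 2 5] S[of 1 2] S[of 1 5] S[of 4 2] S[of 4 5] \<omega> \<rho>(2) in simp_all)
qed

lemma open_umbrella_not_K_solution:
  assumes "c \<noteq> 0" "open_umbrella M_K theta_K f"
  shows "\<not> generalized_geometric_solution M_K theta_K (omega_K c) f"
proof
  assume sol: "generalized_geometric_solution M_K theta_K (omega_K c) f"
  obtain W F \<rho> where
    W: "open W" "0 \<in> W" "Ck_on 2 W F" "F ` W \<subseteq> M_K" and \<rho>: "\<rho> differentiable at 0" "\<rho> 0 \<noteq> 0"
    and contact: "\<forall>\<^sub>F x in nhds 0. \<forall>v. pullback1 F theta_K x v = \<rho> x * theta_Hess x v"
    and zero: "\<forall>\<^sub>F w in nhds 0. \<forall>v v'. pullback2 (F \<circ> umbrella_model) (omega_K c) w v v' = 0"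
    by (rule umbrella_solution_normal_form[OF assms(2) sol])
  define L where "L i = frechet_derivative F (at 0) (axis i 1)" for i :: 5
  have skew: "omega_K c m v w = - omega_K c m w v" for m v w
    by (simp add: omega_K_def wedge_def algebra_simps Let_def)
  note \<omega>0 = umbrella_pullback_zero[OF W(1-3) bilinear_omega_K _ omega_K_curve_derivative zero]
  have \<omega>: "omega_K c (F 0) (L 1) (L 2) = 0" "omega_K c (F 0) (L 1) (L 5) = 0"
    "omega_K c (F 0) (L 1) (L 4) = omega_K c (F 0) (L 2) (L 5)"
    unfolding L_def using \<omega>0 skew by blast+
  let ?D = "frechet_derivative F (at 0)"
  have \<sigma>: "snd (?D v) \<bullet> fst (?D w)
      - (snd (?D w) \<bullet> fst (?D v))
      = \<rho> 0 * (w $ 4 * v $ 1 - v $ 4 * w $ 1 + (w $ 5 * v $ 2 - v $ 5 * w $ 2))"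
    if vw: "v $ 3 = 0" "w $ 3 = 0" for v w
  proof (rule contact_pullback_symplectic[where \<tau> = "\<lambda>a b. snd a \<bullet> fst b",
        OF W(1-3) \<rho>(1) _ contact vw])
    fix m V :: "real \<Rightarrow> (real^3) \<times> (real^3)" and m' V'
    assume "(m has_vector_derivative m') (at 0)" "(V has_vector_derivative V') (at 0)"
    then show "((\<lambda>t. theta_K (m t) (V t)) has_real_derivative
        theta_K (m 0) V' + (snd m' \<bullet> fst (V 0))) (at 0)"
      by (rule theta_K_curve_derivative)
  qed
  \<comment> \<open>No sign change occurs here, as the left-hand side is the exterior derivative of
    \<open>theta_K\<close> itself.\<close>
  have S: "snd (L i) \<bullet> fst (L j) - snd (L j) \<bullet> fst (L i)
      = \<rho> 0 * (of_bool (j = 4) * of_bool (i = 1) - of_bool (i = 4) * of_bool (j = 1)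
          + (of_bool (j = 5) * of_bool (i = 2) - of_bool (i = 5) * of_bool (j = 2)))"
    if "i \<noteq> 3" "j \<noteq> 3" for i j
    unfolding L_def
    using \<sigma>[where v = "axis i 1" and w = "axis j 1"] that
    by (simp add: axis_nth)
  have tangent: "snd (F 0) \<bullet> snd v = 0" if "v \<in> {L 1, L 2, L 4, L 5}" for v
    using derivative_tangent_sphere[OF W(1,2,4) Ck_on_2(1)[OF W(1,3,2)]] that by (auto simp: L_def)
  have "F 0 \<in> M_K"
    using W(2,4) by blast
  then have norm: "norm (snd (F 0)) = 1"
    by (auto simp: M_K_def)
  show False
    \<comment> \<open>The arguments are listed in the order \<open>a\<close>, \<open>b\<close>,
      \<open>s\<close>, \<open>t\<close>, so the conjugate pairs are again (\<open>L 1\<close>,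
      \<open>L 4\<close>) and (\<open>L 2\<close>, \<open>L 5\<close>).\<close>
    by (rule no_isotropic_symplectic_quadruple_K[OF assms(1) \<rho>(2) norm, of "L 1" "L 2" "L 4" "L 5"])
      (use S[of 1 4] S[of 2 5] S[of 1 2] S[of 1 5] S[of 4 2] S[of 4 5] \<omega> in \<open>simp_all add: tangent\<close>)
qed

unbundle no cross3_syntax

theorem proposition1p7:
  fixes c :: real
  assumes "c \<noteq> 0"
  shows "(\<forall>f :: real^2 \<Rightarrow> real^5. open_umbrella UNIV theta_Hess f \<longrightarrow>
            \<not> generalized_geometric_solution UNIV theta_Hess (omega_Hess c) f) \<and>
         (\<forall>f :: real^2 \<Rightarrow> (real^3) \<times> (real^3). open_umbrella M_K theta_K f \<longrightarrow>
            \<not> generalized_geometric_solution M_K theta_K (omega_K c) f)"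
  using assms open_umbrella_not_Hess_solution open_umbrella_not_K_solution by blast

end
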